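(* There exist a connected hyperbolic complex manifold $M$ and a holomorphic automorphism $f$ of $M$ such that the fixed point set $\mathrm{Fix}(f)=\{x\in M : f(x)=x\}$ is discrete and infinite.
   Context: A complex manifold is hyperbolic if it is Kobayashi hyperbolic, i.e. its Kobayashi pseudodistance is a distance. A holomorphic automorphism is a biholomorphic self-map. *)

theory Defs
  imports "HOL-Analysis.Analysis"
begin

section \<open>Holomorphic maps between open subsets of complex coordinate spaces\<close>

text \<open>
  The space of \<open>n\<close>-tuples of complex numbers, where \<open>n\<close> is a term and not a type: sequences that
  vanish from index \<open>n\<close> on, as in \<^const>\<open>Euclidean_space\<close>.  The subspace topology of the product
  topology is the usual topology.
\<close>

definition complex_space :: "nat \<Rightarrow> (nat \<Rightarrow> complex) topology" where
  "complex_space n = top_of_set {z. \<forall>i\<ge>n. z i = 0}"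

text \<open>
  Complex (Frechet) differentiability at every point of an open subset \<open>W\<close> of
  \<^term>\<open>complex_space n\<close>, with \<open>c\<close> the vector of complex partial derivatives at \<open>a\<close>.
\<close>

definition holomorphic_fun :: "nat \<Rightarrow> (nat \<Rightarrow> complex) set \<Rightarrow> ((nat \<Rightarrow> complex) \<Rightarrow> complex) \<Rightarrow> bool" where
  "holomorphic_fun n W g \<longleftrightarrow>
     (\<forall>a\<in>W. \<exists>c :: nat \<Rightarrow> complex.
        ((\<lambda>z. (g z - g a - (\<Sum>j<n. c j * (z j - a j)))
               / complex_of_real (L2_set (\<lambda>j. cmod (z j - a j)) {..<n})) \<longlongrightarrow> 0) (at a within W))"

definition holomorphic_map ::
  "nat \<Rightarrow> nat \<Rightarrow> (nat \<Rightarrow> complex) set \<Rightarrow> ((nat \<Rightarrow> complex) \<Rightarrow> (nat \<Rightarrow> complex)) \<Rightarrow> bool" where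
  "holomorphic_map n m W F \<longleftrightarrow> (\<forall>i<m. holomorphic_fun n W (\<lambda>z. F z i))"


section \<open>Complex manifolds\<close>

type_synonym 'a chart = "'a set \<times> ('a \<Rightarrow> nat \<Rightarrow> complex)"

text \<open>A chart \<open>(U, \<phi>)\<close>; the values of \<open>\<phi>\<close> outside \<open>U\<close> are irrelevant.\<close>

definition is_chart :: "nat \<Rightarrow> 'a topology \<Rightarrow> 'a chart \<Rightarrow> bool" where
  "is_chart n X = (\<lambda>(U, \<phi>).
     openin X U \<and> openin (complex_space n) (\<phi> ` U) \<and>
     homeomorphic_map (subtopology X U) (subtopology (complex_space n) (\<phi> ` U)) \<phi>)"

text \<open>
  The manifold is the space \<open>X\<close> with the complex structure generated by the atlas \<open>A\<close>, which need
  not be maximal.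
\<close>

definition complex_manifold :: "nat \<Rightarrow> 'a topology \<Rightarrow> 'a chart set \<Rightarrow> bool" where
  "complex_manifold n X A \<longleftrightarrow>
     Hausdorff_space X \<and> second_countable X \<and>
     (\<forall>C\<in>A. is_chart n X C) \<and>
     (\<Union>(U, \<phi>)\<in>A. U) = topspace X \<and>
     (\<forall>(U, \<phi>)\<in>A. \<forall>(V, \<psi>)\<in>A. holomorphic_map n n (\<phi> ` (U \<inter> V)) (\<psi> \<circ> inv_into U \<phi>))"

definition holomorphic_manifold_map ::
  "nat \<Rightarrow> 'a topology \<Rightarrow> 'a chart set \<Rightarrow> nat \<Rightarrow> 'b topology \<Rightarrow> 'b chart set \<Rightarrow> ('a \<Rightarrow> 'b) \<Rightarrow> bool" where
  "holomorphic_manifold_map n X A m Y B f \<longleftrightarrow>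
     continuous_map X Y f \<and>
     (\<forall>(U, \<phi>)\<in>A. \<forall>(V, \<psi>)\<in>B.
        holomorphic_map n m (\<phi> ` {x\<in>U. f x \<in> V}) (\<psi> \<circ> f \<circ> inv_into U \<phi>))"

definition holomorphic_automorphism :: "nat \<Rightarrow> 'a topology \<Rightarrow> 'a chart set \<Rightarrow> ('a \<Rightarrow> 'a) \<Rightarrow> bool" where
  "holomorphic_automorphism n X A f \<longleftrightarrow>
     bij_betw f (topspace X) (topspace X) \<and>
     holomorphic_manifold_map n X A n X A f \<and>
     holomorphic_manifold_map n X A n X A (inv_into (topspace X) f)"


section \<open>The Kobayashi pseudodistance\<close>

text \<open>Holomorphic maps from the open unit disc into the manifold.\<close>

definition holomorphic_disc :: "nat \<Rightarrow> 'a topology \<Rightarrow> 'a chart set \<Rightarrow> (complex \<Rightarrow> 'a) \<Rightarrow> bool" where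
  "holomorphic_disc n X A h \<longleftrightarrow>
     continuous_map (top_of_set (ball 0 1)) X h \<and>
     (\<forall>(U, \<phi>)\<in>A. \<forall>i<n. (\<lambda>z. \<phi> (h z) i) holomorphic_on {z \<in> ball 0 1. h z \<in> U})"

text \<open>
  The distance of the Poincare metric of curvature \<open>-1\<close> on the unit disc; equivalently
  \<open>ln ((1 + t) / (1 - t))\<close> where \<open>t\<close> is the pseudohyperbolic distance.
\<close>

definition poincare_dist :: "complex \<Rightarrow> complex \<Rightarrow> real" where
  "poincare_dist a b = 2 * artanh (cmod ((a - b) / (1 - cnj b * a)))"

text \<open>
  The infimum of the lengths of chains of holomorphic discs \<open>h 0, \<dots>, h (k - 1)\<close> joining \<open>x\<close> to \<open>y\<close>
  through the points \<open>x = p 0, p 1, \<dots>, p k = y\<close>.  It is \<open>\<infinity>\<close> if there is no chain, which does not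
  happen on a connected manifold.
\<close>

definition kobayashi_pseudodist :: "nat \<Rightarrow> 'a topology \<Rightarrow> 'a chart set \<Rightarrow> 'a \<Rightarrow> 'a \<Rightarrow> ennreal" where
  "kobayashi_pseudodist n X A x y =
     Inf {(\<Sum>i<k. ennreal (poincare_dist (a i) (b i))) | (k :: nat) a b h p.
            p 0 = x \<and> p k = y \<and>
            (\<forall>i<k. a i \<in> ball 0 1 \<and> b i \<in> ball 0 1 \<and> holomorphic_disc n X A (h i) \<and>
                   h i (a i) = p i \<and> h i (b i) = p (Suc i))}"

text \<open>
  For connected manifolds, on which the pseudodistance is finite and \<^const>\<open>enn2real\<close> is only a
  coercion.
\<close>

definition kobayashi_hyperbolic :: "nat \<Rightarrow> 'a topology \<Rightarrow> 'a chart set \<Rightarrow> bool" where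
  "kobayashi_hyperbolic n X A \<longleftrightarrow>
     Metric_space (topspace X) (\<lambda>x y. enn2real (kobayashi_pseudodist n X A x y))"


definition fixed_points :: "'a topology \<Rightarrow> ('a \<Rightarrow> 'a) \<Rightarrow> 'a set" where
  "fixed_points X f = {x \<in> topspace X. f x = x}"

text \<open>
  A statement that a complex manifold exists has to name a type for its points.  The type
  \<^typ>\<open>complex \<times> complex\<close> serves only as a set of the cardinality of the continuum: the
  topology and the atlas are arbitrary and need not be related to those of \<^typ>\<open>complex \<times> complex\<close>.
  This is no restriction, since a second countable manifold has at most continuum many points, so
  that every complex manifold, of any dimension, is biholomorphic to one of this kind.
\<close>

end

theory Submission
  imports Defs "HOL-Complex_Analysis.Riemann_Mapping"
begin

text \<open>
  \<open>M\<close> is the part over \<open>Re x < 1\<close> of the hyperelliptic curve \<open>exp x + y\<^sup>2 = 1\<close> of infinite genus,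
  and \<open>f\<close> is the involution \<open>(x, y) \<mapsto> (x, - y)\<close>, whose fixed points are the points
  \<open>(2 k \<pi> \<i>, 0)\<close>.  Since \<open>exp x \<noteq> 0\<close>, the function \<open>y\<close> is a local coordinate everywhere, including at
  the branch points.  \<open>M\<close> is hyperbolic because the bounded holomorphic functions \<open>y\<close> and
  \<open>exp (s x)\<close>, \<open>s > 0\<close>, separate its points: by the Schwarz lemma a holomorphic function bounded
  by \<open>1\<close> is \<open>1\<close>-Lipschitz from the Kobayashi pseudodistance to the euclidean distance.
\<close>

section \<open>The Kobayashi pseudodistance\<close>

text \<open>The chain condition inside \<open>kobayashi_pseudodist\<close>, named so that chains can
  be reversed and concatenated.\<close>

definition disc_chain ::
  "nat \<Rightarrow> 'a topology \<Rightarrow> 'a chart set \<Rightarrow> 'a \<Rightarrow> 'a \<Rightarrow> nat \<Rightarrow>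
    (nat \<Rightarrow> complex) \<Rightarrow> (nat \<Rightarrow> complex) \<Rightarrow> (nat \<Rightarrow> complex \<Rightarrow> 'a) \<Rightarrow> (nat \<Rightarrow> 'a) \<Rightarrow> bool" where
  "disc_chain n X A x y k a b h p \<longleftrightarrow>
     p 0 = x \<and> p k = y \<and>
     (\<forall>i<k. a i \<in> ball 0 1 \<and> b i \<in> ball 0 1 \<and> holomorphic_disc n X A (h i) \<and>
            h i (a i) = p i \<and> h i (b i) = p (Suc i))"

lemma kobayashi_pseudodist_chains:
  "kobayashi_pseudodist n X A x y =
     Inf {(\<Sum>i<k. ennreal (poincare_dist (a i) (b i))) | k a b h p. disc_chain n X A x y k a b h p}"
  unfolding kobayashi_pseudodist_def disc_chain_def ..

lemma kobayashi_pseudodist_le: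
  "disc_chain n X A x y k a b h p \<Longrightarrow>
   kobayashi_pseudodist n X A x y \<le> (\<Sum>i<k. ennreal (poincare_dist (a i) (b i)))"
  unfolding kobayashi_pseudodist_chains by (intro Inf_lower) blast

lemma kobayashi_pseudodist_ge:
  assumes "\<And>k a b h p. disc_chain n X A x y k a b h p \<Longrightarrow>
             L \<le> (\<Sum>i<k. ennreal (poincare_dist (a i) (b i)))"
  shows "L \<le> kobayashi_pseudodist n X A x y"
  unfolding kobayashi_pseudodist_chains using assms by (intro Inf_greatest) blast

section \<open>Pseudometric axioms for the extended-valued pseudodistance\<close>

lemma poincare_dist_commute: "poincare_dist a b = poincare_dist b a"
proof -
  have "cmod (1 - cnj b * a) = cmod (1 - cnj a * b)"
    by (subst complex_mod_cnj[symmetric]) (simp add: mult.commute)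
  then show ?thesis
    by (simp add: poincare_dist_def norm_divide norm_minus_commute)
qed

lemma kobayashi_pseudodist_refl [simp]: "kobayashi_pseudodist n X A x x = 0"
proof -
  \<comment> \<open>The empty chain; with length 0 the discs and their marked points are never
    consulted.\<close>
  have "disc_chain n X A x x 0 undefined undefined undefined (\<lambda>_. x)"
    by (simp add: disc_chain_def)
  from kobayashi_pseudodist_le[OF this] show ?thesis by simp
qed

text \<open>The discs are traversed backwards with their marked points exchanged. There are
  \<open>k\<close> discs but \<open>k + 1\<close> points, hence \<open>k - Suc i\<close> for the
  former and \<open>k - i\<close> for the latter.\<close>

lemma disc_chain_rev:
  assumes "disc_chain n X A x y k a b h p"
  shows "disc_chain n X A y x k (\<lambda>i. b (k - Suc i)) (\<lambda>i. a (k - Suc i)) (\<lambda>i. h (k - Suc i)) (\<lambda>i. p (k - i))"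
  using assms by (auto simp: disc_chain_def Suc_diff_Suc)

lemma kobayashi_pseudodist_commute:
  "kobayashi_pseudodist n X A x y = kobayashi_pseudodist n X A y x"
proof -
  have "kobayashi_pseudodist n X A x y \<le> kobayashi_pseudodist n X A y x" for x y
  proof (rule kobayashi_pseudodist_ge)
    fix k a b h p
    assume "disc_chain n X A y x k a b h p"
    from kobayashi_pseudodist_le[OF disc_chain_rev[OF this]]
    show "kobayashi_pseudodist n X A x y \<le> (\<Sum>i<k. ennreal (poincare_dist (a i) (b i)))"
      using sum.nat_diff_reindex[of "\<lambda>i. ennreal (poincare_dist (a i) (b i))" k]
      by (simp add: poincare_dist_commute)
  qed
  then show ?thesis by (blast intro: antisym)
qed

lemma disc_chain_append:
  assumes "disc_chain n X A x y k a b h p" "disc_chain n X A y z k' a' b' h' p'"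
  shows "disc_chain n X A x z (k + k')
           (\<lambda>i. if i < k then a i else a' (i - k)) (\<lambda>i. if i < k then b i else b' (i - k))
           (\<lambda>i. if i < k then h i else h' (i - k)) (\<lambda>i. if i < k then p i else p' (i - k))"
  unfolding disc_chain_def
proof (intro conjI allI impI)
  fix i assume i: "i < k + k'"
  \<comment> \<open>At the junction \<open>Suc i = k\<close> the disc belongs to the first chain and
    its end point to the second; \<open>p k = y = p' 0\<close> reconciles them.\<close>
  consider "Suc i < k" | "Suc i = k" | "k \<le> i" by linarith
  then show "(if i < k then h i else h' (i - k)) (if i < k then b i else b' (i - k)) =
             (if Suc i < k then p (Suc i) else p' (Suc i - k))"
    using assms i by cases (auto simp: disc_chain_def Suc_diff_le)
qed (use assms in \<open>auto simp: disc_chain_def\<close>)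

lemma kobayashi_pseudodist_triangle:
  "kobayashi_pseudodist n X A x z \<le> kobayashi_pseudodist n X A x y + kobayashi_pseudodist n X A y z"
proof (cases "kobayashi_pseudodist n X A y z = \<infinity>")
  case False
  let ?d = "kobayashi_pseudodist n X A"
  let ?S = "\<lambda>(k::nat) a b. (\<Sum>i<k. ennreal (poincare_dist (a i) (b i)))"
  \<comment> \<open>Subtraction isolates one infimum at a time, so that each can be bounded chain by
    chain. Finiteness of the subtracted term allows moving it back in \<open>ennreal\<close>, hence
    the case distinction.\<close>
  have "?d x z - ?d y z \<le> ?d x y"
  proof (rule kobayashi_pseudodist_ge)
    fix k a b h p assume c: "disc_chain n X A x y k a b h p"
    have fin: "?S k a b \<noteq> \<infinity>" by simp
    have "?d x z - ?S k a b \<le> ?d y z"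
    proof (rule kobayashi_pseudodist_ge)
      fix k' a' b' h' p' assume c': "disc_chain n X A y z k' a' b' h' p'"
      have "?d x z \<le> (\<Sum>i<k+k'. ennreal (poincare_dist (if i < k then a i else a' (i - k)) (if i < k then b i else b' (i - k))))"
        using kobayashi_pseudodist_le[OF disc_chain_append[OF c c']] .
      also have "\<dots> = ?S k a b + ?S k' a' b'"
        by (induction k') (simp_all add: add.assoc)
      finally show "?d x z - ?S k a b \<le> ?S k' a' b'"
        using fin by (simp add: ennreal_minus_le_iff)
    qed
    then show "?d x z - ?d y z \<le> ?S k a b"
      using fin False by (simp add: ennreal_minus_le_iff add.commute)
  qed
  then show ?thesis
    using False by (simp add: ennreal_minus_le_iff add.commute)
qed simp

text \<open>The Schwarz lemma, applied to \<open>(g \<circ> m - g b) / 2\<close> for a Moebius transformation \<open>m\<close> with \<open>m 0 = b\<close>.\<close>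

lemma cmod_diff_le_poincare_dist:
  assumes g: "g holomorphic_on ball 0 1" and less: "\<And>z. cmod z < 1 \<Longrightarrow> cmod (g z) < 1"
    and a: "cmod a < 1" and b: "cmod b < 1"
  shows "cmod (g a - g b) \<le> poincare_dist a b"
proof -
  let ?m = "Moebius_function 0 (-b)"
  define w where "w = Moebius_function 0 b a"
  \<comment> \<open>Halving keeps the difference of two values of \<open>g\<close> in the unit disc;
    the lost factor 2 is the one in \<open>poincare_dist\<close>.\<close>
  define k where "k = (\<lambda>z. (g (?m z) - g b) / 2)"
  have m1: "cmod (?m z) < 1" if "cmod z < 1" for z
    using Moebius_function_norm_lt_1[of "-b" z 0] b that by simp
  have w1: "cmod w < 1"
    using Moebius_function_norm_lt_1[OF b a] by (simp add: w_def)
  have mw: "?m w = a"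
    unfolding w_def using Moebius_function_compose[of "-b" b a] a b by simp
  have "g \<circ> ?m holomorphic_on ball 0 1"
    using b m1 by (intro holomorphic_on_compose_gen[OF Moebius_function_holomorphic g]) auto
  then have "k holomorphic_on ball 0 1"
    unfolding k_def by (intro holomorphic_intros) (auto simp: o_def)
  moreover have "k 0 = 0"
    by (simp add: k_def Moebius_function_simple)
  moreover have "cmod (k z) < 1" if "cmod z < 1" for z
    using norm_triangle_ineq4[of "g (?m z)" "g b"] less[OF m1[OF that]] less[OF b]
    by (simp add: k_def norm_divide)
  ultimately have "cmod (k w) \<le> cmod w"
    using w1 by (rule Schwarz_Lemma)
  then have "cmod (g a - g b) \<le> 2 * cmod w"
    by (simp add: k_def mw norm_divide)
  also have "cmod w \<le> artanh (cmod w)"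
  proof -
    let ?t = "cmod w"
    \<comment> \<open>The function \<open>artanh s - s\<close> vanishes at 0 and has derivative
      \<open>1 / (1 - s\<^sup>2) - 1\<close>, which is nonnegative on the interval.\<close>
    have "artanh 0 - 0 \<le> artanh ?t - ?t"
    proof (rule DERIV_nonneg_imp_nondecreasing[where f = "\<lambda>s. artanh s - s"])
      fix s assume s: "0 \<le> s" "s \<le> ?t"
      then have "s\<^sup>2 < 1" using w1 by (simp add: power_less_one_iff abs_square_less_1)
      then show "\<exists>D. ((\<lambda>s. artanh s - s) has_real_derivative D) (at s) \<and> 0 \<le> D"
        using s w1 by (intro exI[of _ "1 / (1 - s\<^sup>2) - 1"])
          (auto intro!: derivative_eq_intros simp: field_simps)
    qed simp
    then show ?thesis by simp
  qed
  also have "2 * artanh (cmod w) = poincare_dist a b"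
    by (simp add: w_def poincare_dist_def Moebius_function_simple)
  finally show ?thesis by simp
qed

text \<open>The Schwarz bound for \<open>F / B\<close> on each disc telescopes along a chain, so
  every chain has length at least \<open>cmod (F x - F y) / B\<close>. Holomorphy of
  \<open>F\<close> is asked for only along discs, which is all that the bound uses.\<close>

lemma kobayashi_pseudodist_pos:
  assumes F: "\<And>h. holomorphic_disc n X A h \<Longrightarrow> F \<circ> h holomorphic_on ball 0 1"
    and B: "\<And>p. p \<in> topspace X \<Longrightarrow> cmod (F p) < B" and x: "x \<in> topspace X" and neq: "F x \<noteq> F y"
  shows "kobayashi_pseudodist n X A x y > 0"
proof -
  have B0: "B > 0" using B[OF x] norm_ge_zero[of "F x"] by linarith
  have "ennreal (cmod (F x - F y) / B) \<le> kobayashi_pseudodist n X A x y"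
  proof (rule kobayashi_pseudodist_ge)
    fix k a b h p assume c: "disc_chain n X A x y k a b h p"
    have step: "cmod (F (p i) - F (p (Suc i))) / B \<le> poincare_dist (a i) (b i)" if "i < k" for i
    proof -
      have h: "holomorphic_disc n X A (h i)" and ab: "cmod (a i) < 1" "cmod (b i) < 1"
        and p: "h i (a i) = p i" "h i (b i) = p (Suc i)"
        using c that by (auto simp: disc_chain_def)
      have "h i z \<in> topspace X" if "cmod z < 1" for z
        using h that by (auto simp: holomorphic_disc_def continuous_map_def Pi_iff)
      then have "cmod ((F \<circ> h i) a / B - (F \<circ> h i) b / B) \<le> poincare_dist a b"
        if "cmod a < 1" "cmod b < 1" for a b
        using that B B0
        by (intro cmod_diff_le_poincare_dist[of "\<lambda>z. (F \<circ> h i) z / B"] holomorphic_intros F h)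
           (auto simp: norm_divide)
      from this[OF ab] p B0 show ?thesis
        by (simp add: norm_divide flip: diff_divide_distrib)
    qed
    have "F x - F y = - (\<Sum>i<k. F (p (Suc i)) - F (p i))"
      using c by (subst sum_lessThan_telescope) (auto simp: disc_chain_def)
    then have "cmod (F x - F y) \<le> (\<Sum>i<k. cmod (F (p i) - F (p (Suc i))))"
      by (simp add: norm_minus_commute sum_norm_le)
    then have "cmod (F x - F y) / B \<le> (\<Sum>i<k. cmod (F (p i) - F (p (Suc i))) / B)"
      using B0 by (simp add: divide_right_mono flip: sum_divide_distrib)
    also have "\<dots> \<le> (\<Sum>i<k. poincare_dist (a i) (b i))"
      by (intro sum_mono step) simp
    finally have "ennreal (cmod (F x - F y) / B) \<le> ennreal (\<Sum>i<k. poincare_dist (a i) (b i))"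
      by (rule ennreal_leI)
    \<comment> \<open>Since \<open>ennreal\<close> truncates negative reals, each summand must be
      nonnegative; this follows from \<open>step\<close>.\<close>
    also have "\<dots> = (\<Sum>i<k. ennreal (poincare_dist (a i) (b i)))"
    proof (rule sum_ennreal[symmetric])
      fix i assume "i \<in> {..<k}"
      then show "0 \<le> poincare_dist (a i) (b i)"
        using order_trans[OF divide_nonneg_pos[OF norm_ge_zero B0] step[of i]] by simp
    qed
    finally show "ennreal (cmod (F x - F y) / B) \<le> (\<Sum>i<k. ennreal (poincare_dist (a i) (b i)))" .
  qed
  moreover have "ennreal (cmod (F x - F y) / B) > 0"
    using neq B0 by simp
  ultimately show ?thesis by (rule less_le_trans[rotated])
qed

text \<open>The points at finite distance from \<open>x\<close> form an open and closed set: local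
  finiteness and the triangle inequality transfer finiteness between a point and its neighbours in
  both directions.\<close>

lemma kobayashi_pseudodist_finite:
  assumes conn: "connected_space X"
    and loc: "\<And>x. x \<in> topspace X \<Longrightarrow>
                \<exists>N. openin X N \<and> x \<in> N \<and> (\<forall>y\<in>N. kobayashi_pseudodist n X A x y < \<infinity>)"
    and x: "x \<in> topspace X" and y: "y \<in> topspace X"
  shows "kobayashi_pseudodist n X A x y < \<infinity>"
proof -
  let ?d = "kobayashi_pseudodist n X A"
  have tri: "?d u w < \<infinity>" if "?d u v < \<infinity>" "?d v w < \<infinity>" for u v w
    using that kobayashi_pseudodist_triangle[of n X A u w v] ennreal_add_less_top 
    by (simp add: order_le_less_trans)
  define S where "S = {v \<in> topspace X. ?d x v < \<infinity>}"
  have "openin X S"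
    unfolding openin_subopen[of X S]
  proof
    fix v assume v: "v \<in> S"
    then obtain N where N: "openin X N" "v \<in> N" "\<forall>w\<in>N. ?d v w < \<infinity>"
      using loc[of v] unfolding S_def by auto
    then show "\<exists>T. openin X T \<and> v \<in> T \<and> T \<subseteq> S"
      using v tri[of x v] openin_subset[OF N(1)] unfolding S_def by (intro exI[of _ N]) auto
  qed
  moreover have "openin X (topspace X - S)"
    unfolding openin_subopen[of X "topspace X - S"]
  proof
    fix v assume v: "v \<in> topspace X - S"
    then obtain N where N: "openin X N" "v \<in> N" "\<forall>w\<in>N. ?d v w < \<infinity>"
      using loc[of v] by auto
    then have "\<forall>w\<in>N. ?d w v < \<infinity>"
      by (simp add: kobayashi_pseudodist_commute)
    with N show "\<exists>T. openin X T \<and> v \<in> T \<and> T \<subseteq> topspace X - S"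
      using v tri[of x _ v] openin_subset[OF N(1)] unfolding S_def by (intro exI[of _ N]) auto
  qed
  moreover have "x \<in> S"
    using x by (simp add: S_def)
  ultimately have "topspace X - S = {}"
    using conn unfolding connected_space_def by blast
  with y show ?thesis by (auto simp: S_def)
qed

text \<open>On finite values \<open>enn2real\<close> reflects zero and respects order and addition,
  so the axioms already shown in \<open>ennreal\<close> carry over.\<close>

lemma kobayashi_hyperbolicI:
  assumes "\<And>x y. x \<in> topspace X \<Longrightarrow> y \<in> topspace X \<Longrightarrow> kobayashi_pseudodist n X A x y < \<infinity>"
    and "\<And>x y. x \<in> topspace X \<Longrightarrow> y \<in> topspace X \<Longrightarrow> x \<noteq> y \<Longrightarrow> kobayashi_pseudodist n X A x y > 0"
  shows "kobayashi_hyperbolic n X A"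
  unfolding kobayashi_hyperbolic_def
proof
  fix x y z assume M: "x \<in> topspace X" "y \<in> topspace X" "z \<in> topspace X"
  show "enn2real (kobayashi_pseudodist n X A x y) = 0 \<longleftrightarrow> x = y"
    using assms[OF M(1,2)] by (cases "x = y") (auto simp: enn2real_eq_0_iff)
  have "enn2real (kobayashi_pseudodist n X A x z)
          \<le> enn2real (kobayashi_pseudodist n X A x y + kobayashi_pseudodist n X A y z)"
    using assms(1) M by (intro enn2real_mono kobayashi_pseudodist_triangle) simp
  also have "\<dots> = enn2real (kobayashi_pseudodist n X A x y) + enn2real (kobayashi_pseudodist n X A y z)"
    using assms(1) M by (intro enn2real_plus) auto
  finally show "enn2real (kobayashi_pseudodist n X A x z) \<le>
      enn2real (kobayashi_pseudodist n X A x y) + enn2real (kobayashi_pseudodist n X A y z)" .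
qed (auto simp: kobayashi_pseudodist_commute)

section \<open>The curve\<close>

definition curve :: "(complex \<times> complex) set" where
  "curve = {p. exp (fst p) + (snd p)\<^sup>2 = 1 \<and> Re (fst p) < 1}"

text \<open>The exponential is injective on a strip of height \<open>2 * pi\<close>, so the second
  component determines the point within a sheet.\<close>

definition sheet :: "real \<Rightarrow> (complex \<times> complex) set" where
  "sheet t = {p \<in> curve. \<bar>Im (fst p) - t\<bar> < pi}"

text \<open>The range of the second component on \<open>sheet t\<close>. As
  \<open>1 - y\<^sup>2\<close> is \<open>exp x\<close>, the first condition encodes
  \<open>Re x < 1\<close>; the second keeps the value, rotated by \<open>- t\<close>, off the cut of
  \<open>Ln\<close>.\<close>

definition sheet_image :: "real \<Rightarrow> complex set" where
  "sheet_image t = {y. cmod (1 - y\<^sup>2) < exp 1 \<and> exp (- \<i> * of_real t) * (1 - y\<^sup>2) \<notin> \<real>\<^sub>\<le>\<^sub>0}"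

text \<open>The branch of the logarithm of \<open>1 - y\<^sup>2\<close> with imaginary part within
  \<open>pi\<close> of \<open>t\<close>; it recovers the first component.\<close>

definition sheet_log :: "real \<Rightarrow> complex \<Rightarrow> complex" where
  "sheet_log t y = \<i> * of_real t + Ln (exp (- \<i> * of_real t) * (1 - y\<^sup>2))"

text \<open>One function serves all charts, so every transition map is an identity.\<close>

definition coord :: "complex \<times> complex \<Rightarrow> nat \<Rightarrow> complex" where
  "coord p = (\<lambda>i. if i = 0 then snd p else 0)"

definition atlas :: "(complex \<times> complex) chart set" where
  "atlas = range (\<lambda>t. (sheet t, coord))"

lemma coord_0 [simp]: "coord p 0 = snd p"
  by (simp add: coord_def)

lemma curveD: "p \<in> curve \<Longrightarrow> exp (fst p) = 1 - (snd p)\<^sup>2"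
  by (simp add: curve_def eq_diff_eq)

lemma sheet_log_in_sheet:
  assumes "y \<in> sheet_image t"
  shows "(sheet_log t y, y) \<in> sheet t"
proof -
  let ?w = "exp (- \<i> * of_real t) * (1 - y\<^sup>2)"
  have w: "?w \<notin> \<real>\<^sub>\<le>\<^sub>0" "?w \<noteq> 0" and less: "cmod ?w < exp 1"
    using assms by (auto simp: sheet_image_def norm_mult)
  have "exp (sheet_log t y) = exp (\<i> * of_real t) * ?w"
    using w(2) by (simp add: sheet_log_def exp_add)
  also have "\<dots> = 1 - y\<^sup>2"
    by (simp add: exp_minus)
  finally have "exp (sheet_log t y) = 1 - y\<^sup>2" .
  moreover have "Re (sheet_log t y) < 1"
    using less w(2) ln_less_cancel_iff[of "cmod ?w" "exp 1"] by (simp add: sheet_log_def)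
  moreover have "\<bar>Im (sheet_log t y) - t\<bar> < pi"
    using Im_Ln_less_pi[OF w(1)] mpi_less_Im_Ln[OF w(2)] by (simp add: sheet_log_def)
  ultimately show ?thesis
    by (simp add: sheet_def curve_def)
qed

text \<open>After rotation \<open>1 - y\<^sup>2\<close> is \<open>exp (x - \<i> * t)\<close>, whose
  exponent has imaginary part strictly between \<open>- pi\<close> and \<open>pi\<close>; the
  principal logarithm therefore returns it.\<close>

lemma
  assumes p: "p \<in> sheet t"
  shows snd_in_sheet_image: "snd p \<in> sheet_image t"
    and sheet_log_snd: "sheet_log t (snd p) = fst p"
proof -
  let ?u = "fst p - \<i> * of_real t"
  have e: "exp (- \<i> * of_real t) * (1 - (snd p)\<^sup>2) = exp ?u"
    using p by (simp add: sheet_def curveD exp_diff exp_minus field_simps flip: curveD)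
  have Im: "-pi < Im ?u" "Im ?u < pi" and Re: "Re (fst p) < 1"
    using p by (auto simp: sheet_def curve_def)
  have Ln: "Ln (exp ?u) = ?u"
    using Im by (intro Ln_exp) auto
  then show "sheet_log t (snd p) = fst p"
    unfolding sheet_log_def e by simp
  \<comment> \<open>A nonzero point of the cut has a principal logarithm with imaginary part
    \<open>pi\<close>, which the strict bound excludes.\<close>
  have "exp ?u \<notin> \<real>\<^sub>\<le>\<^sub>0"
    using Im_Ln_eq_pi[of "exp ?u"] Im exp_not_eq_zero[of ?u] unfolding Ln by (auto simp: complex_nonpos_Reals_iff le_less complex_eq_iff)
  moreover have "cmod (1 - (snd p)\<^sup>2) < exp 1"
    using p Re by (simp add: sheet_def flip: curveD)
  ultimately show "snd p \<in> sheet_image t"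
    unfolding sheet_image_def mem_Collect_eq e by blast
qed

lemma open_sheet_image: "open (sheet_image t)"
proof -
  have "sheet_image t = (\<lambda>y. 1 - y\<^sup>2) -` ball 0 (exp 1) \<inter> (\<lambda>y. exp (- \<i> * of_real t) * (1 - y\<^sup>2)) -` (- \<real>\<^sub>\<le>\<^sub>0)"
    by (auto simp: sheet_image_def)
  then show ?thesis
    by (auto intro!: open_Int open_vimage continuous_intros)
qed

lemma holomorphic_sheet_log: "sheet_log t holomorphic_on sheet_image t"
  unfolding sheet_log_def by (intro holomorphic_intros) (auto simp: sheet_image_def)

lemma openin_sheet: "openin (top_of_set curve) (sheet t)"
proof -
  have "sheet t = curve \<inter> (\<lambda>p. \<bar>Im (fst p) - t\<bar>) -` {..<pi}"
    by (auto simp: sheet_def)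
  then show ?thesis
    by (auto intro!: openin_open_Int open_vimage continuous_intros)
qed

text \<open>The image is cut out by an open condition on coordinate 0, and \<open>sheet_log\<close>
  supplies a continuous inverse on it.\<close>

lemma is_chart_sheet: "is_chart 1 (top_of_set curve) (sheet t, coord)"
proof -
  let ?Z = "{z :: nat \<Rightarrow> complex. \<forall>i\<ge>1. z i = 0}"
  have img: "coord ` sheet t = ?Z \<inter> (\<lambda>z. z 0) -` sheet_image t"
  proof (intro equalityI subsetI)
    fix z assume z: "z \<in> ?Z \<inter> (\<lambda>z. z 0) -` sheet_image t"
    then have "z = coord (sheet_log t (z 0), z 0)"
      by (auto simp: coord_def fun_eq_iff)
    with z show "z \<in> coord ` sheet t"
      using sheet_log_in_sheet by fast
  qed (use snd_in_sheet_image in \<open>fastforce simp: coord_def\<close>)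
  have sub: "subtopology (top_of_set curve) (sheet t) = top_of_set (sheet t)"
    by (simp add: subtopology_subtopology sheet_def Int_absorb1 Collect_mono_iff subset_eq)
  have subZ: "subtopology (complex_space 1) (coord ` sheet t) = top_of_set (coord ` sheet t)"
    unfolding complex_space_def subtopology_subtopology img by (simp add: Int_assoc[symmetric])
  have "homeomorphic_maps (top_of_set (sheet t)) (top_of_set (coord ` sheet t)) coord
          (\<lambda>z. (sheet_log t (z 0), z 0))"
    unfolding homeomorphic_maps_def
  proof (intro conjI ballI)
    have "continuous_on (sheet t) (\<lambda>p. coord p i)" for i
      by (cases "i = 0") (auto simp: coord_def intro!: continuous_intros)
    then show "continuous_map (top_of_set (sheet t)) (top_of_set (coord ` sheet t)) coord"
      by (auto intro!: continuous_on_coordinatewise_then_product)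
    have *: "continuous_on S (\<lambda>z :: nat \<Rightarrow> complex. z 0)" for S
      by (rule continuous_on_subset[OF continuous_on_product_coordinates]) simp
    have "continuous_on (coord ` sheet t) (\<lambda>z. sheet_log t (z 0))"
      by (rule continuous_on_compose2[OF holomorphic_on_imp_continuous_on[OF holomorphic_sheet_log] *])
         (auto simp: img)
    then show "continuous_map (top_of_set (coord ` sheet t)) (top_of_set (sheet t)) (\<lambda>z. (sheet_log t (z 0), z 0))"
      using * by (auto intro!: continuous_on_Pair sheet_log_in_sheet dest: snd_in_sheet_image)
  qed (auto simp: coord_def sheet_log_snd)
  then have "homeomorphic_map (subtopology (top_of_set curve) (sheet t))
               (subtopology (complex_space 1) (coord ` sheet t)) coord"
    unfolding sub subZ homeomorphic_map_maps by blast
  moreover have "openin (complex_space 1) (coord ` sheet t)"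
    unfolding img complex_space_def
    by (intro openin_open_Int open_vimage open_sheet_image) simp
  ultimately show ?thesis
    by (simp add: is_chart_def openin_sheet)
qed

section \<open>The complex structure, with the second component as coordinate\<close>

lemma inv_into_coord:
  assumes "p \<in> sheet t"
  shows "inv_into (sheet t) coord (coord p) = p"
proof (rule inv_into_f_f[OF _ assms])
  show "inj_on coord (sheet t)"
  proof (rule inj_onI)
    fix p q assume "p \<in> sheet t" "q \<in> sheet t" "coord p = coord q"
    then show "p = q"
      by (metis coord_def prod_eqI sheet_log_snd)
  qed
qed

text \<open>Covers the transition maps (\<open>s = 1\<close>) and the involution
  (\<open>s = -1\<close>). A linear map is its own derivative, so the numerator of the quotient
  vanishes identically on \<open>W\<close>.\<close>

lemma holomorphic_map_scale:
  assumes "\<And>z. z \<in> W \<Longrightarrow> F z 0 = s * z 0"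
  shows "holomorphic_map 1 1 W F"
proof -
  have "((\<lambda>z. (F z 0 - F a 0 - (\<Sum>j<1. s * (z j - a j)))
               / complex_of_real (L2_set (\<lambda>j. cmod (z j - a j)) {..<1})) \<longlongrightarrow> 0) (at a within W)"
    if "a \<in> W" for a
    using assms that
    by (intro tendsto_eventually) (auto simp: eventually_at_filter algebra_simps intro!: always_eventually)
  then show ?thesis
    unfolding holomorphic_map_def holomorphic_fun_def by (auto intro!: exI[of _ "\<lambda>_. s"])
qed

lemma mem_sheet_Im: "p \<in> curve \<Longrightarrow> p \<in> sheet (Im (fst p))"
  by (simp add: sheet_def)

lemma complex_manifold_curve: "complex_manifold 1 (top_of_set curve) atlas"
  unfolding complex_manifold_def
proof (intro conjI)
  have "second_countable (euclidean :: (complex \<times> complex) topology)"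
    by (metis ex_countable_basis second_countable_def topological_basis_def UNIV_I open_openin topological_basisE)
  then show "second_countable (top_of_set curve)"
    by (rule second_countable_subtopology)
  show "(\<Union>(U, \<phi>)\<in>atlas. U) = topspace (top_of_set curve)"
    using mem_sheet_Im openin_subset[OF openin_sheet] unfolding atlas_def by fastforce
  have "holomorphic_map 1 1 (coord ` (sheet t \<inter> sheet u)) (coord \<circ> inv_into (sheet t) coord)" for t u
    by (rule holomorphic_map_scale[where s = 1]) (auto simp: inv_into_coord)
  then show "\<forall>(U, \<phi>)\<in>atlas. \<forall>(V, \<psi>)\<in>atlas. holomorphic_map 1 1 (\<phi> ` (U \<inter> V)) (\<psi> \<circ> inv_into U \<phi>)"
    by (auto simp: atlas_def)
qed (use is_chart_sheet in \<open>auto simp: atlas_def Hausdorff_space_subtopology\<close>)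

lemma holomorphic_manifold_map_scale:
  assumes "continuous_on curve g" "g ` curve \<subseteq> curve" "\<And>p. p \<in> curve \<Longrightarrow> snd (g p) = s * snd p"
  shows "holomorphic_manifold_map 1 (top_of_set curve) atlas 1 (top_of_set curve) atlas g"
proof -
  have "snd (g p) = s * snd p" if "p \<in> sheet t" for p t
    using that assms(3) by (simp add: sheet_def)
  then have "holomorphic_map 1 1 (coord ` {x \<in> sheet t. g x \<in> sheet u}) (coord \<circ> g \<circ> inv_into (sheet t) coord)"
    for t u
    by (intro holomorphic_map_scale) (auto simp: inv_into_coord)
  then show ?thesis
    using assms(1,2) by (auto simp: holomorphic_manifold_map_def atlas_def)
qed

section \<open>The involution and its fixed points\<close>

definition flip :: "complex \<times> complex \<Rightarrow> complex \<times> complex" where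
  "flip p = (fst p, - snd p)"

lemma flip_flip [simp]: "flip (flip p) = p"
  by (simp add: flip_def)

lemma flip_in_curve_iff [simp]: "flip p \<in> curve \<longleftrightarrow> p \<in> curve"
  by (simp add: flip_def curve_def)

lemma holomorphic_automorphism_flip: "holomorphic_automorphism 1 (top_of_set curve) atlas flip"
proof -
  have bij: "bij_betw flip curve curve"
    by (rule bij_betw_byWitness[where f' = flip]) auto
  \<comment> \<open>Stated for any map agreeing with \<open>flip\<close> on the curve, so that it
    also applies to the inverse, which is given by \<open>inv_into\<close>.\<close>
  have hol: "holomorphic_manifold_map 1 (top_of_set curve) atlas 1 (top_of_set curve) atlas g"
    if "\<And>p. p \<in> curve \<Longrightarrow> g p = flip p" for g
  proof (rule holomorphic_manifold_map_scale[where s = "-1"])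
    have "continuous_on curve flip"
      unfolding flip_def by (intro continuous_intros)
    then show "continuous_on curve g"
      using that by (simp cong: continuous_on_cong)
    show "snd (g p) = - 1 * snd p" if "p \<in> curve" for p
      using \<open>\<And>p. p \<in> curve \<Longrightarrow> g p = flip p\<close>[OF that] by (simp add: flip_def)
  qed (use that in auto)
  have "inv_into curve flip p = flip p" if "p \<in> curve" for p
    using bij that by (intro inv_into_f_eq) (auto simp: bij_betw_def)
  then show ?thesis
    using bij hol by (simp add: holomorphic_automorphism_def)
qed

text \<open>A fixed point has second component 0, so \<open>exp (fst p) = 1\<close>; all solutions
  have real part 0 and thus satisfy \<open>Re x < 1\<close>.\<close>

lemma fixed_points_flip: "fixed_points (top_of_set curve) flip = range (\<lambda>k::int. (2 * of_int k * of_real pi * \<i>, 0))"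
proof -
  have "p \<in> curve \<and> flip p = p \<longleftrightarrow> (\<exists>k::int. p = (2 * of_int k * of_real pi * \<i>, 0))" for p
    by (auto simp: flip_def curve_def prod_eq_iff exp_eq_1 complex_eq_iff[of "fst p"])
  then show ?thesis
    by (auto simp: fixed_points_def)
qed

lemma infinite_fixed_points_flip: "infinite (fixed_points (top_of_set curve) flip)"
  unfolding fixed_points_flip
  using finite_imageD[of _ "UNIV :: int set"] infinite_UNIV_int by (fastforce simp: inj_on_def)

lemma discrete_fixed_points_flip:
  "subtopology (top_of_set curve) (fixed_points (top_of_set curve) flip) =
   discrete_topology (fixed_points (top_of_set curve) flip)"
proof -
  let ?F = "fixed_points (top_of_set curve) flip"
  have "?F \<subseteq> curve" by (auto simp: fixed_points_def)
  then have sub: "subtopology (top_of_set curve) ?F = top_of_set ?F"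
    by (simp add: subtopology_subtopology Int_absorb1)
  have "openin (top_of_set ?F) {p}" if "p \<in> ?F" for p
  proof -
    \<comment> \<open>Imaginary parts of distinct fixed points differ by at least
      \<open>2 * pi\<close>, so this strip isolates \<open>p\<close>.\<close>
    have "?F \<inter> (\<lambda>q. \<bar>Im (fst q) - Im (fst p)\<bar>) -` {..<2 * pi} = {p}"
    proof -
      have "k = l" if "\<bar>2 * real_of_int k * pi - 2 * real_of_int l * pi\<bar> < 2 * pi" for k l :: int
      proof -
        have "2 * real_of_int k * pi - 2 * real_of_int l * pi = real_of_int (k - l) * (2 * pi)"
          by (simp add: algebra_simps)
        with that have "\<bar>real_of_int (k - l)\<bar> * (2 * pi) < 2 * pi"
          by (simp add: abs_mult)
        then have "\<bar>real_of_int (k - l)\<bar> < 1" by simp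
        then show ?thesis by linarith
      qed
      then show ?thesis
        using that unfolding fixed_points_flip by auto
    qed
    moreover have "openin (top_of_set ?F) (?F \<inter> (\<lambda>q. \<bar>Im (fst q) - Im (fst p)\<bar>) -` {..<2 * pi})"
      by (intro openin_open_Int open_vimage continuous_intros)
    ultimately show ?thesis by simp
  qed
  then have "discrete_topology ?F = top_of_set ?F"
    by (simp add: discrete_topology_unique)
  with sub show ?thesis by simp
qed

section \<open>Connectedness of the curve\<close>

text \<open>Continuity at 0 comes from \<open>cmod (csqrt z) = sqrt (cmod z)\<close>. Including 0
  allows graphs through branch points.\<close>

lemma continuous_on_csqrt_0: "continuous_on (insert 0 (- \<real>\<^sub>\<le>\<^sub>0)) csqrt"
proof -
  have "((\<lambda>z. sqrt (cmod z)) \<longlongrightarrow> sqrt (cmod 0)) (at 0)"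
    by (intro tendsto_intros)
  then have "csqrt \<midarrow>0\<rightarrow> 0"
    by (simp add: tendsto_norm_zero_cancel)
  then have "isCont csqrt 0"
    by (simp add: isCont_def)
  then show ?thesis
    using continuous_at_csqrt by (intro continuous_at_imp_continuous_on) blast
qed

text \<open>A continuous branch of the square root of \<open>1 - exp u\<close> over a convex set
  lifts that set to a connected piece of the curve.\<close>

lemma
  assumes "convex S" "continuous_on S g" "\<And>u. u \<in> S \<Longrightarrow> (g u)\<^sup>2 = 1 - exp u" "\<And>u. u \<in> S \<Longrightarrow> Re u < 1"
  shows connected_graph: "connected ((\<lambda>u. (u, g u)) ` S)"
    and graph_subset_curve: "(\<lambda>u. (u, g u)) ` S \<subseteq> curve"
proof -
  show "connected ((\<lambda>u. (u, g u)) ` S)"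
    by (intro connected_continuous_image continuous_intros assms convex_connected)
  show "(\<lambda>u. (u, g u)) ` S \<subseteq> curve"
    using assms by (auto simp: curve_def)
qed

text \<open>For \<open>Re u \<le> 0\<close> the value \<open>1 - exp u\<close> avoids the cut except
  at 0, so the principal root is continuous. Its graph and the negated one cover this part and meet
  at the branch point \<open>(0, 0)\<close>.\<close>

lemma connected_curve_left: "connected {p \<in> curve. Re (fst p) \<le> 0}"
proof -
  let ?H = "{u. Re u \<le> 0}"
  define G where "G = (\<lambda>s. (\<lambda>u. (u, s * csqrt (1 - exp u))) ` ?H)"
  have slit: "1 - exp u \<in> insert 0 (- \<real>\<^sub>\<le>\<^sub>0)" if "Re u \<le> 0" for u :: complex
  proof -
    have "Re (exp u) \<le> 1"
      using complex_Re_le_cmod[of "exp u"] that by (simp add: order_trans)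
    then show ?thesis
      by (auto simp: complex_nonpos_Reals_iff complex_eq_iff)
  qed
  then have "(\<lambda>u. 1 - exp u) ` ?H \<subseteq> insert 0 (- \<real>\<^sub>\<le>\<^sub>0)"
    by blast
  then have "continuous_on ?H (\<lambda>u. csqrt (1 - exp u))"
    by (intro continuous_on_compose2[OF continuous_on_csqrt_0] continuous_intros)
  then have cont: "continuous_on ?H (\<lambda>u. s * csqrt (1 - exp u))" for s
    by (intro continuous_intros)
  have conn: "connected (G s)" and sub: "G s \<subseteq> curve" if "s\<^sup>2 = 1" for s
    unfolding G_def using that
    by (intro connected_graph graph_subset_curve cont; auto simp: convex_halfspace_Re_le power_mult_distrib)+
  have "(0, 0) \<in> G 1 \<inter> G (-1)"
    by (auto simp: G_def image_iff)
  then have "connected (G 1 \<union> G (-1))"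
    by (intro connected_Un conn) auto
  moreover have "{p \<in> curve. Re (fst p) \<le> 0} = G 1 \<union> G (-1)"
  proof (intro equalityI subsetI)
    fix p assume p: "p \<in> {p \<in> curve. Re (fst p) \<le> 0}"
    then have "(snd p)\<^sup>2 = (csqrt (1 - exp (fst p)))\<^sup>2"
      by (simp add: curveD)
    then have "snd p = csqrt (1 - exp (fst p)) \<or> snd p = - csqrt (1 - exp (fst p))"
      by (simp only: power2_eq_iff)
    then show "p \<in> G 1 \<union> G (-1)"
      using p by (auto simp: G_def image_iff prod_eq_iff)
  qed (use sub[of 1] sub[of "-1"] in \<open>auto simp: G_def\<close>)
  ultimately show ?thesis by simp
qed

text \<open>On a horizontal segment in the right half plane either \<open>exp u - 1\<close> stays real and nonnegative
  or \<open>1 - exp u\<close> avoids the branch cut of the square root.\<close>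

lemma square_root_on_horizontal_segment:
  fixes x :: complex
  assumes "Re x > 0"
  obtains g where "continuous_on (closed_segment x (\<i> * of_real (Im x))) g" "\<And>u. (g u)\<^sup>2 = 1 - exp u"
proof (cases "\<exists>n::int. Im x = 2 * n * pi")
  let ?S = "closed_segment x (\<i> * of_real (Im x))"
  have S: "Im u = Im x" "0 \<le> Re u" if "u \<in> ?S" for u
    using that assms by (auto simp: closed_segment_def) (simp add: left_diff_distrib)
  case True
  have "exp u - 1 \<in> insert 0 (- \<real>\<^sub>\<le>\<^sub>0)" if u: "u \<in> ?S" for u
  proof -
    obtain n :: int where "Im x = 2 * n * pi"
      using True by auto
    with S(1)[OF u] have "u = of_real (Re u) + of_real (of_int (2 * n) * pi) * \<i>"
      by (simp add: complex_eq_iff)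
    then have "exp u = exp (of_real (Re u))"
      unfolding exp_eq by blast
    then have "exp u = of_real (exp (Re u))"
      by (simp only: exp_of_real)
    moreover have "exp (Re u) \<ge> 1" using S(2)[OF u] by simp
    ultimately show ?thesis
      by (auto simp: complex_nonpos_Reals_iff complex_eq_iff)
  qed
  then have "(\<lambda>u. exp u - 1) ` ?S \<subseteq> insert 0 (- \<real>\<^sub>\<le>\<^sub>0)"
    by blast
  \<comment> \<open>Here \<open>1 - exp u\<close> runs along the cut; the root is taken of its
    negative, and the factor \<open>\<i>\<close> restores the sign on squaring.\<close>
  then have "continuous_on ?S (\<lambda>u. \<i> * csqrt (exp u - 1))"
    by (intro continuous_on_mult_left continuous_on_compose2[OF continuous_on_csqrt_0] continuous_intros)
  then show ?thesis
    by (rule that) (simp add: power_mult_distrib)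
next
  let ?S = "closed_segment x (\<i> * of_real (Im x))"
  have S: "Im u = Im x" if "u \<in> ?S" for u
    using that by (auto simp: closed_segment_def left_diff_distrib)
  case False
  \<comment> \<open>A value on the cut would make \<open>exp u\<close> real and at least 1, hence
    \<open>Im u\<close> a multiple of \<open>2 * pi\<close>, against the case assumption.\<close>
  have "1 - exp u \<in> - \<real>\<^sub>\<le>\<^sub>0" if u: "u \<in> ?S" for u
  proof
    assume "1 - exp u \<in> \<real>\<^sub>\<le>\<^sub>0"
    then have r: "Re (exp u) \<ge> 1" "Im (exp u) = 0"
      by (auto simp: complex_nonpos_Reals_iff)
    then have "exp u = exp (of_real (ln (Re (exp u))))"
      by (simp add: exp_of_real complex_eq_iff del: Re_exp)
    then obtain n :: int where "u = of_real (ln (Re (exp u))) + of_real (of_int (2 * n) * pi) * \<i>"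
      unfolding exp_eq by auto
    then have "Im u = Im (of_real (ln (Re (exp u))) + of_real (of_int (2 * n) * pi) * \<i>)"
      by (rule arg_cong)
    also have "\<dots> = 2 * real_of_int n * pi" by simp
    finally have "Im u = 2 * real_of_int n * pi" .
    with False S[OF u] show False by metis
  qed
  then have "(\<lambda>u. 1 - exp u) ` ?S \<subseteq> - \<real>\<^sub>\<le>\<^sub>0"
    by blast
  then have "continuous_on ?S (\<lambda>u. csqrt (1 - exp u))"
    by (intro continuous_on_compose2[OF continuous_on_csqrt] continuous_intros)
  then show ?thesis
    by (rule that) simp
qed

text \<open>A point with positive real part is joined to the connected left part by lifting the
  horizontal segment from its first component to the imaginary axis.\<close>

lemma connected_space_curve: "connected_space (top_of_set curve)"
proof -
  let ?L = "{p \<in> curve. Re (fst p) \<le> 0}"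
  have L: "connected ?L" "(0, 0) \<in> ?L"
    using connected_curve_left by (auto simp: curve_def)
  have "connected_component curve (0, 0) p" if p: "p \<in> curve" for p
  proof (cases "Re (fst p) \<le> 0")
    case True
    then show ?thesis
      unfolding connected_component_def using p L by (intro exI[of _ ?L]) blast
  next
    case False
    let ?S = "closed_segment (fst p) (\<i> * of_real (Im (fst p)))"
    obtain g where g: "continuous_on ?S g" "\<And>u. (g u)\<^sup>2 = 1 - exp u"
      using square_root_on_horizontal_segment[of "fst p"] False by auto
    have "(snd p)\<^sup>2 = (g (fst p))\<^sup>2"
      using p by (simp add: g(2) curveD)
    \<comment> \<open>The sign \<open>s\<close> selects the lift that passes through
      \<open>p\<close>.\<close>
    then obtain s where s: "s\<^sup>2 = 1" "snd p = s * g (fst p)"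
      unfolding power2_eq_iff by (metis mult_1 mult_minus1 power2_minus one_power2)
    let ?T = "(\<lambda>u. (u, s * g u)) ` ?S"
    have "convex ?S" by simp
    moreover have "continuous_on ?S (\<lambda>u. s * g u)"
      by (intro continuous_intros g)
    moreover have "(s * g u)\<^sup>2 = 1 - exp u" for u
      using s g by (simp add: power_mult_distrib)
    moreover have "Re u < 1" if "u \<in> ?S" for u
    proof -
      have "?S \<subseteq> {u. Re u < 1}"
        using p by (intro closed_segment_subset) (auto simp: curve_def convex_halfspace_Re_lt)
      with that show ?thesis by auto
    qed
    ultimately have T: "connected ?T" "?T \<subseteq> curve"
      by (intro connected_graph graph_subset_curve; blast)+
    have pT: "p \<in> ?T"
      using s by (auto simp: image_iff prod_eq_iff intro!: bexI[of _ "fst p"])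
    have "(\<i> * of_real (Im (fst p)), s * g (\<i> * of_real (Im (fst p)))) \<in> ?T"
      by (intro imageI) simp
    then have "?T \<inter> ?L \<noteq> {}"
      using T(2) by force
    then have "connected (?T \<union> ?L)"
      using T L by (intro connected_Un)
    then show ?thesis
      unfolding connected_component_def using T(2) pT L(2)
      by (intro exI[of _ "?T \<union> ?L"]) blast
  qed
  then have "connected curve"
    unfolding connected_iff_connected_component
    by (meson connected_component_sym connected_component_trans)
  then show ?thesis
    by (simp add: connectedin_def flip: connectedin_iff_connected)
qed

section \<open>Hyperbolicity of the curve\<close>

text \<open>The charts see only the second component. The first is locally
  \<open>sheet_log t\<close> of it, on the open preimages of the sheets, which cover the
  disc.\<close>

lemma
  assumes h: "holomorphic_disc 1 (top_of_set curve) atlas h"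
  shows holomorphic_disc_fst: "fst \<circ> h holomorphic_on ball 0 1"
    and holomorphic_disc_snd: "snd \<circ> h holomorphic_on ball 0 1"
proof -
  define S where "S = (\<lambda>t. {z \<in> ball 0 1. h z \<in> sheet t})"
  have cont: "continuous_map (top_of_set (ball 0 1)) (top_of_set curve) h"
    using h by (simp add: holomorphic_disc_def)
  have "openin (top_of_set (ball 0 1)) (S t)" for t
    using openin_continuous_map_preimage[OF cont openin_sheet] by (simp add: S_def)
  then have "open (S t)" for t
    by (simp add: openin_open_eq)
  have cover: "ball 0 1 = (\<Union>t. S t)"
    using cont mem_sheet_Im by (fastforce simp: S_def)
  have snd_S: "snd \<circ> h holomorphic_on S t" for t
    using h by (auto simp: holomorphic_disc_def atlas_def S_def o_def)
  then show "snd \<circ> h holomorphic_on ball 0 1"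
    unfolding cover using \<open>\<And>t. open (S t)\<close> by (intro holomorphic_on_UN_open) auto
  have "sheet_log t \<circ> (snd \<circ> h) holomorphic_on S t" for t
    by (rule holomorphic_on_compose_gen[OF snd_S holomorphic_sheet_log]) (auto simp: S_def dest: snd_in_sheet_image)
  then have "fst \<circ> h holomorphic_on S t" for t
    by (rule holomorphic_transform) (auto simp: S_def sheet_log_snd)
  then show "fst \<circ> h holomorphic_on ball 0 1"
    unfolding cover using \<open>\<And>t. open (S t)\<close> by (intro holomorphic_on_UN_open) auto
qed

text \<open>Points with equal second component have first components differing by a multiple of
  \<open>2 * pi * \<i>\<close>, invisible to \<open>exp x\<close> but not to
  \<open>exp (s * x)\<close> for small \<open>s\<close>. The bound on \<open>Re x\<close> makes both
  separating functions bounded.\<close>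

lemma kobayashi_pseudodist_curve_pos:
  assumes p: "p \<in> curve" and q: "q \<in> curve" and "p \<noteq> q"
  shows "kobayashi_pseudodist 1 (top_of_set curve) atlas p q > 0"
proof (cases "snd p = snd q")
  case False
  have bound: "cmod (snd r) < 2" if "r \<in> curve" for r
  proof -
    have "(cmod (snd r))\<^sup>2 = cmod (1 - exp (fst r))"
      using that by (simp add: curveD norm_power)
    also have "\<dots> \<le> 1 + exp (Re (fst r))"
      using norm_triangle_ineq4[of 1 "exp (fst r)"] by simp
    also have "exp (Re (fst r)) < exp 1"
      using that by (simp add: curve_def)
    finally have "(cmod (snd r))\<^sup>2 < 2\<^sup>2"
      using exp_le by simp
    then show ?thesis by (rule power2_less_imp_less) simp
  qed
  show ?thesis
    by (rule kobayashi_pseudodist_pos[where F = snd and B = 2, OF holomorphic_disc_snd]) (use p False bound in auto)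
next
  case True
  \<comment> \<open>Chosen so that the scaled imaginary parts differ by less than 1, where
    \<open>exp\<close> cannot identify the two values.\<close>
  define s where "s = 1 / (1 + \<bar>Im (fst p) - Im (fst q)\<bar>)"
  have s: "s > 0" by (simp add: s_def add_pos_nonneg)
  let ?F = "\<lambda>r :: complex \<times> complex. exp (of_real s * fst r)"
  show ?thesis
  proof (rule kobayashi_pseudodist_pos)
    show "?F \<circ> h holomorphic_on ball 0 1" if "holomorphic_disc 1 (top_of_set curve) atlas h" for h
    proof -
      have "(\<lambda>z. exp (of_real s * (fst \<circ> h) z)) holomorphic_on ball 0 1"
        by (intro holomorphic_intros holomorphic_disc_fst that)
      then show ?thesis by (simp add: o_def)
    qed
    show "cmod (?F r) < exp s" if "r \<in> topspace (top_of_set curve)" for r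
      using that s by (auto simp: curve_def)
    show "?F p \<noteq> ?F q"
    proof
      assume "?F p = ?F q"
      moreover have "\<bar>Im (of_real s * fst p) - Im (of_real s * fst q)\<bar> < 2 * pi"
      proof -
        have "Im (of_real s * fst p) - Im (of_real s * fst q) = s * (Im (fst p) - Im (fst q))"
          by (simp add: right_diff_distrib)
        then have "\<bar>Im (of_real s * fst p) - Im (of_real s * fst q)\<bar> = s * \<bar>Im (fst p) - Im (fst q)\<bar>"
          using s by (simp add: abs_mult)
        also have "\<dots> < 1" unfolding s_def by (simp add: pos_divide_less_eq add_pos_nonneg)
        finally show ?thesis using pi_gt3 by linarith
      qed
      ultimately have "of_real s * fst p = of_real s * fst q"
        by (rule exp_complex_eqI[rotated])
      with s True \<open>p \<noteq> q\<close> show False by (simp add: prod_eq_iff)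
    qed
  qed (use p in simp)
qed

text \<open>A ball in the coordinate lifts to a single holomorphic disc centred at \<open>p\<close>
  that passes through every point of \<open>N\<close>, so chains of length 1 suffice.\<close>

lemma kobayashi_pseudodist_curve_finite_near:
  assumes p: "p \<in> curve"
  shows "\<exists>N. openin (top_of_set curve) N \<and> p \<in> N \<and>
             (\<forall>q\<in>N. kobayashi_pseudodist 1 (top_of_set curve) atlas p q < \<infinity>)"
proof -
  define t where "t = Im (fst p)"
  have pt: "p \<in> sheet t"
    using mem_sheet_Im[OF p] by (simp add: t_def)
  obtain r where r: "r > 0" and ball: "ball (snd p) r \<subseteq> sheet_image t"
    using open_sheet_image snd_in_sheet_image[OF pt] open_contains_ball by metis
  define m where "m = (\<lambda>z. snd p + of_real r * z)"
  define h where "h = (\<lambda>z. (sheet_log t (m z), m z))"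
  \<comment> \<open>Restricting to \<open>sheet t\<close> is essential: equal second components
    force equal points only within one sheet.\<close>
  define N where "N = sheet t \<inter> (curve \<inter> snd -` ball (snd p) r)"
  have m: "m z \<in> sheet_image t" if "z \<in> ball 0 1" for z
    using that r ball by (force simp: m_def dist_norm norm_mult)
  have cont_m: "continuous_on (ball 0 1) m"
    unfolding m_def by (intro continuous_intros)
  have "continuous_on (ball 0 1) (\<lambda>z. sheet_log t (m z))"
    by (rule continuous_on_compose2[OF holomorphic_on_imp_continuous_on[OF holomorphic_sheet_log] cont_m])
       (use m in auto)
  moreover have "h z \<in> curve" if "z \<in> ball 0 1" for z
    using sheet_log_in_sheet[OF m[OF that]] by (simp add: h_def sheet_def)
  ultimately have "continuous_map (top_of_set (ball 0 1)) (top_of_set curve) h"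
    using cont_m unfolding h_def by (auto intro!: continuous_on_Pair)
  then have disc: "holomorphic_disc 1 (top_of_set curve) atlas h"
    by (auto simp: holomorphic_disc_def atlas_def h_def m_def intro!: holomorphic_intros)
  have "kobayashi_pseudodist 1 (top_of_set curve) atlas p q < \<infinity>" if "q \<in> N" for q
  proof -
    define b where "b = (snd q - snd p) / of_real r"
    have "cmod b < 1"
      using that r by (auto simp: N_def b_def norm_divide dist_norm norm_minus_commute)
    moreover have "m b = snd q" "m 0 = snd p"
      using r by (auto simp: m_def b_def)
    then have "h b = q" "h 0 = p"
      using that pt by (auto simp: h_def N_def sheet_log_snd)
    ultimately have "disc_chain 1 (top_of_set curve) atlas p q 1 (\<lambda>_. 0) (\<lambda>_. b) (\<lambda>_. h)
            (\<lambda>i. if i = 0 then p else q)"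
      using disc by (auto simp: disc_chain_def)
    from kobayashi_pseudodist_le[OF this] show ?thesis
      by (simp add: order_le_less_trans)
  qed
  moreover have "openin (top_of_set curve) N"
    unfolding N_def by (intro openin_Int openin_sheet openin_open_Int open_vimage continuous_intros) auto
  moreover have "p \<in> N"
    using p pt r by (simp add: N_def)
  ultimately show ?thesis by blast
qed

lemma kobayashi_hyperbolic_curve: "kobayashi_hyperbolic 1 (top_of_set curve) atlas"
proof (rule kobayashi_hyperbolicI)
  fix p q assume "p \<in> topspace (top_of_set curve)" "q \<in> topspace (top_of_set curve)"
  then show "kobayashi_pseudodist 1 (top_of_set curve) atlas p q < \<infinity>"
    by (intro kobayashi_pseudodist_finite connected_space_curve kobayashi_pseudodist_curve_finite_near) auto
qed (use kobayashi_pseudodist_curve_pos in auto)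

theorem proposition1p4:
  shows "\<exists>(n :: nat) (X :: (complex \<times> complex) topology) (A :: (complex \<times> complex) chart set) f.
           complex_manifold n X A \<and> connected_space X \<and> kobayashi_hyperbolic n X A \<and>
           holomorphic_automorphism n X A f \<and>
           subtopology X (fixed_points X f) = discrete_topology (fixed_points X f) \<and>
           infinite (fixed_points X f)"
  by (intro exI conjI) (fact complex_manifold_curve connected_space_curve kobayashi_hyperbolic_curve holomorphic_automorphism_flip
      discrete_fixed_points_flip infinite_fixed_points_flip)+

end
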